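(* Let $R$ be a ring, let $\mathcal{D}$ be a definable subcategory of $\mathrm{Mod}\text{-}R$, and suppose that $M\in\mathcal{D}$ is strictly $\mathcal{D}$-atomic and is finitely generated over its endomorphism ring. Let $R_M$ be the ring of definable scalars of $M$. Then $R_M=\mathrm{Biend}(M_R)$, the biendomorphism ring $\mathrm{End}_{\mathrm{End}(M_R)}(M)$ of $M_R$.
   Context: $\mathrm{Mod}\text{-}R$ is the category of right $R$-modules. A pp formula $\phi(\overline{x})$ is an existentially quantified finite system of $R$-linear equations $\exists\overline{y}\,\bigwedge_{j} \sum_i x_ir_{ij}+\sum_k y_ks_{kj}=0$; $\phi(M)$ denotes its solution set in $M$. For a finite tuple $\overline{a}$ from $M$, $\mathrm{pp}^M(\overline{a})=\{\phi \text{ pp}:\overline{a}\in\phi(M)\}$. A pp-pair is a pair $\phi,\psi$ of pp formulas in the same free variables with $\psi(M)\subseteq\phi(M)$ for all $M$. A definable subcategory of $\mathrm{Mod}\text{-}R$ is a full subcategory consisting of all $M$ with $\phi(M)=\psi(M)$ for every pair $(\phi,\psi)$ in some given set of pp-pairs. $\phi\leq_{\mathcal{D}}\psi$ means $\phi(D)\subseteq\psi(D)$ for all $D\in\mathcal{D}$, and $\langle\phi\rangle_{\mathcal{D}}=\{\psi\text{ pp}:\phi\leq_{\mathcal{D}}\psi\}$. $M\in\mathcal{D}$ is strictly $\mathcal{D}$-atomic if for every finite tuple $\overline{a}$ from $M$ there is a pp formula $\phi$ with $\mathrm{pp}^M(\overline{a})=\langle\phi\rangle_{\mathcal{D}}$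 and, for each such $\overline{a},\phi$ and every $D\in\mathcal{D}$ and $\overline{b}\in\phi(D)$, there is a morphism $f:M\to D$ with $f\overline{a}=\overline{b}$. The ring $R_M$ of definable scalars of $M$ is the ring of all pp-definable maps on $M$, i.e. the (necessarily additive) functions $M\to M$ whose graph is $\rho(M)$ for some pp formula $\rho(x,y)$ in two free variables, under addition and composition, acting on $M$ on the right. (Each such formula also defines a function on every module in the definable subcategory generated by $M$.) $\mathrm{Biend}(M_R)$, also acting on the right, is the ring of endomorphisms of $M$ regarded as a left $\mathrm{End}(M_R)$-module. The equality is of rings of additive self-maps of $M$. *)

theory Defs
  imports "HOL-Algebra.Module" "HOL-Library.FuncSet"
begin

text \<open>Right modules over a not necessarily commutative ring, carried by the record
  \<^typ>\<open>('r, 'm) module\<close> of HOL-Algebra. For a right module, \<open>r \<odot>\<^bsub>M\<^esub> x\<close> stands for the product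
  that is written x r on paper; the order of the scalars shows in \<open>act_assoc\<close>.
  The \<open>mult\<close> and \<open>one\<close> fields of the record play no role.\<close>

locale right_module = R?: ring R + M?: abelian_group M
  for R (structure) and M (structure) +
  assumes act_closed: "\<lbrakk>r \<in> carrier R; x \<in> carrier M\<rbrakk> \<Longrightarrow> r \<odot>\<^bsub>M\<^esub> x \<in> carrier M"
    and act_add_scalar: "\<lbrakk>r \<in> carrier R; s \<in> carrier R; x \<in> carrier M\<rbrakk>
      \<Longrightarrow> (r \<oplus>\<^bsub>R\<^esub> s) \<odot>\<^bsub>M\<^esub> x = r \<odot>\<^bsub>M\<^esub> x \<oplus>\<^bsub>M\<^esub> s \<odot>\<^bsub>M\<^esub> x"
    and act_add: "\<lbrakk>r \<in> carrier R; x \<in> carrier M; y \<in> carrier M\<rbrakk>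
      \<Longrightarrow> r \<odot>\<^bsub>M\<^esub> (x \<oplus>\<^bsub>M\<^esub> y) = r \<odot>\<^bsub>M\<^esub> x \<oplus>\<^bsub>M\<^esub> r \<odot>\<^bsub>M\<^esub> y"
    and act_assoc: "\<lbrakk>r \<in> carrier R; s \<in> carrier R; x \<in> carrier M\<rbrakk>
      \<Longrightarrow> (r \<otimes>\<^bsub>R\<^esub> s) \<odot>\<^bsub>M\<^esub> x = s \<odot>\<^bsub>M\<^esub> (r \<odot>\<^bsub>M\<^esub> x)"
    and act_one: "x \<in> carrier M \<Longrightarrow> \<one>\<^bsub>R\<^esub> \<odot>\<^bsub>M\<^esub> x = x"

text \<open>Linear maps, endomorphism rings and finite generation read the same for left and for
  right modules, as they do not involve products of scalars. Endomorphisms are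
  extensional functions, so that equality of functions is equality on the carrier; the product
  in \<open>End_ring\<close> is composition for maps written on the left.\<close>

definition linear_maps ::
  "('r, 'z) ring_scheme \<Rightarrow> ('r, 'm) module \<Rightarrow> ('r, 'n) module \<Rightarrow> ('m \<Rightarrow> 'n) set" where
  "linear_maps R M N = {f \<in> carrier M \<rightarrow> carrier N.
     (\<forall>x\<in>carrier M. \<forall>y\<in>carrier M. f (x \<oplus>\<^bsub>M\<^esub> y) = f x \<oplus>\<^bsub>N\<^esub> f y) \<and>
     (\<forall>r\<in>carrier R. \<forall>x\<in>carrier M. f (r \<odot>\<^bsub>M\<^esub> x) = r \<odot>\<^bsub>N\<^esub> f x)}"

definition End_ring :: "('r, 'z) ring_scheme \<Rightarrow> ('r, 'm) module \<Rightarrow> ('m \<Rightarrow> 'm) ring" where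
  "End_ring R M =
    \<lparr>carrier = linear_maps R M M \<inter> extensional (carrier M),
     mult = (\<lambda>f g. compose (carrier M) f g),
     one = (\<lambda>x\<in>carrier M. x),
     zero = (\<lambda>x\<in>carrier M. \<zero>\<^bsub>M\<^esub>),
     add = (\<lambda>f g. \<lambda>x\<in>carrier M. f x \<oplus>\<^bsub>M\<^esub> g x)\<rparr>"

definition opposite_ring :: "'a ring \<Rightarrow> 'a ring" where
  "opposite_ring S = S\<lparr>mult := (\<lambda>x y. y \<otimes>\<^bsub>S\<^esub> x)\<rparr>"

definition finitely_generated :: "('r, 'z) ring_scheme \<Rightarrow> ('r, 'm) module \<Rightarrow> bool" where
  "finitely_generated R M \<longleftrightarrow>
    (\<exists>A. finite A \<and> A \<subseteq> carrier M \<and>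
      carrier M = {(\<Oplus>\<^bsub>M\<^esub> a\<in>A. c a \<odot>\<^bsub>M\<^esub> a) | c. c \<in> A \<rightarrow> carrier R})"

text \<open>The abelian group of M as a left module over a ring of self-maps.\<close>

definition eval_module :: "('r, 'm) module \<Rightarrow> ('m \<Rightarrow> 'm, 'm) module" where
  "eval_module M =
    \<lparr>carrier = carrier M, mult = mult M, one = one M, zero = zero M, add = add M,
     smult = (\<lambda>f x. f x)\<rparr>"

text \<open>Biendomorphisms act on the right, hence the opposite ring.\<close>

definition Biend :: "('r, 'z) ring_scheme \<Rightarrow> ('r, 'm) module \<Rightarrow> ('m \<Rightarrow> 'm) ring" where
  "Biend R M = opposite_ring (End_ring (End_ring R M) (eval_module M))"


text \<open>\<open>PP n k E\<close> is the pp formula with free variables x_0, ..., x_(n-1) and quantified variables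
  y_0, ..., y_(k-1), where a pair of coefficient lists (r, s) in E stands for the equation
  sum_i x_i r_i + sum_k y_k s_k = 0. Tuples are lists.\<close>

datatype 'r pp = PP (arity: nat) (bound: nat) (eqns: "('r list \<times> 'r list) list")

definition is_pp :: "('r, 'z) ring_scheme \<Rightarrow> 'r pp \<Rightarrow> bool" where
  "is_pp R \<phi> \<longleftrightarrow> (\<forall>(r, s)\<in>set (eqns \<phi>).
     length r = arity \<phi> \<and> set r \<subseteq> carrier R \<and> length s = bound \<phi> \<and> set s \<subseteq> carrier R)"

definition lin_comb :: "('r, 'm) module \<Rightarrow> 'm list \<Rightarrow> 'r list \<Rightarrow> 'm" where
  "lin_comb M xs r = (\<Oplus>\<^bsub>M\<^esub> i\<in>{..<length xs}. (r ! i) \<odot>\<^bsub>M\<^esub> (xs ! i))"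

definition pp_sol :: "('r, 'm) module \<Rightarrow> 'r pp \<Rightarrow> 'm list set" where
  "pp_sol M \<phi> = {xs. length xs = arity \<phi> \<and> set xs \<subseteq> carrier M \<and>
     (\<exists>ys. length ys = bound \<phi> \<and> set ys \<subseteq> carrier M \<and>
       (\<forall>(r, s)\<in>set (eqns \<phi>). lin_comb M xs r \<oplus>\<^bsub>M\<^esub> lin_comb M ys s = \<zero>\<^bsub>M\<^esub>))}"

definition pp_type :: "('r, 'z) ring_scheme \<Rightarrow> ('r, 'm) module \<Rightarrow> 'm list \<Rightarrow> 'r pp set" where
  "pp_type R M a = {\<phi>. is_pp R \<phi> \<and> a \<in> pp_sol M \<phi>}"

text \<open>All modules of a category have their carriers inside one type \<open>'m\<close>, the universe.
  "All modules" in the definitions below means all modules in this universe. If \<open>'m\<close> is infinite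
  and has at least the cardinality of R, this is the same as quantifying over modules of
  arbitrary size: by the downward Loewenheim-Skolem theorem a finite tuple of a module N lies in an
  elementary submodule of N of cardinality at most max |R| aleph_0. This submodule satisfies the
  same equalities of solution sets as N, gives the tuple the same pp-type, and a morphism into it
  is a morphism into N. The type \<open>univ\<close> is always large enough in this sense, and contains a
  copy of every module with carrier in the arbitrary type \<open>'u\<close>.\<close>

type_synonym ('r, 'u) univ = "'r list + 'u"

definition pp_pairs :: "('r, 'z) ring_scheme \<Rightarrow> 'm itself \<Rightarrow> ('r pp \<times> 'r pp) set" where
  "pp_pairs R _ = {(\<phi>, \<psi>). is_pp R \<phi> \<and> is_pp R \<psi> \<and> arity \<phi> = arity \<psi> \<and>
     (\<forall>N :: ('r, 'm) module. right_module R N \<longrightarrow> pp_sol N \<psi> \<subseteq> pp_sol N \<phi>)}"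

definition definable_subcategory ::
  "('r, 'z) ring_scheme \<Rightarrow> ('r, 'm) module set \<Rightarrow> bool" where
  "definable_subcategory R \<D> \<longleftrightarrow> (\<exists>T \<subseteq> pp_pairs R TYPE('m).
     \<D> = {N. right_module R N \<and> (\<forall>(\<phi>, \<psi>)\<in>T. pp_sol N \<phi> = pp_sol N \<psi>)})"

definition pp_le :: "('r, 'm) module set \<Rightarrow> 'r pp \<Rightarrow> 'r pp \<Rightarrow> bool" where
  "pp_le \<D> \<phi> \<psi> \<longleftrightarrow> arity \<phi> = arity \<psi> \<and> (\<forall>N\<in>\<D>. pp_sol N \<phi> \<subseteq> pp_sol N \<psi>)"

definition pp_filter ::
  "('r, 'z) ring_scheme \<Rightarrow> ('r, 'm) module set \<Rightarrow> 'r pp \<Rightarrow> 'r pp set" where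
  "pp_filter R \<D> \<phi> = {\<psi>. is_pp R \<psi> \<and> pp_le \<D> \<phi> \<psi>}"

definition strictly_atomic ::
  "('r, 'z) ring_scheme \<Rightarrow> ('r, 'm) module set \<Rightarrow> ('r, 'm) module \<Rightarrow> bool" where
  "strictly_atomic R \<D> M \<longleftrightarrow> (\<forall>a. set a \<subseteq> carrier M \<longrightarrow>
     (\<exists>\<phi>. is_pp R \<phi> \<and> pp_type R M a = pp_filter R \<D> \<phi>) \<and>
     (\<forall>\<phi>. is_pp R \<phi> \<and> pp_type R M a = pp_filter R \<D> \<phi> \<longrightarrow>
        (\<forall>N\<in>\<D>. \<forall>b\<in>pp_sol N \<phi>. \<exists>f\<in>linear_maps R M N. map f a = b)))"

text \<open>The maps act on the right, so the product of f and g is f followed by g.\<close>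

definition definable_scalars ::
  "('r, 'z) ring_scheme \<Rightarrow> ('r, 'm) module \<Rightarrow> ('m \<Rightarrow> 'm) ring" where
  "definable_scalars R M =
    \<lparr>carrier = {f \<in> carrier M \<rightarrow>\<^sub>E carrier M.
       \<exists>\<rho>. is_pp R \<rho> \<and> arity \<rho> = 2 \<and> {[x, f x] | x. x \<in> carrier M} = pp_sol M \<rho>},
     mult = (\<lambda>f g. compose (carrier M) g f),
     one = (\<lambda>x\<in>carrier M. x),
     zero = (\<lambda>x\<in>carrier M. \<zero>\<^bsub>M\<^esub>),
     add = (\<lambda>f g. \<lambda>x\<in>carrier M. f x \<oplus>\<^bsub>M\<^esub> g x)\<rparr>"

end

theory Submission
  imports Defs
begin

text \<open>Both rings carry the same operations, so only their underlying sets of maps are compared.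

  A definable scalar f is a biendomorphism because solution sets of pp formulas are closed under
  addition and are preserved by linear maps: the graph of f is then closed under addition
  and under the diagonal action of the endomorphisms of M.

  Conversely, let f be a biendomorphism and let a be an element of M. A pp formula that generates
  the pp-type of the pair (a, f a) has as its solutions in M exactly the images of this pair under
  endomorphisms g: every image is a solution because linear maps preserve pp formulas, and strict
  atomicity realises every solution as an image (\<open>strictly_atomic_orbit\<close>). As f commutes with g,
  the pair (g a, g (f a)) is (g a, f (g a)), so this formula defines the restriction of the graph
  of f to the cyclic submodule that a generates over the endomorphism ring. Sums of pp-definable
  sets are pp-definable (\<open>pp_sol_pp_sum\<close>). If finitely many such cyclic submodules add up to M,
  the sum of their formulas thus defines the whole graph of f, because f is additive.\<close>

section \<open>Linear combinations in right modules\<close>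

context right_module
begin

lemma smult_zero_scalar:
  assumes "x \<in> carrier M" shows "\<zero> \<odot>\<^bsub>M\<^esub> x = \<zero>\<^bsub>M\<^esub>"
proof -
  have "\<zero> \<odot>\<^bsub>M\<^esub> x \<oplus>\<^bsub>M\<^esub> \<zero> \<odot>\<^bsub>M\<^esub> x = \<zero> \<odot>\<^bsub>M\<^esub> x"
    using act_add_scalar[of \<zero> \<zero> x] assms by simp
  then show ?thesis
    using assms act_closed[of \<zero> x] M.add.l_cancel_one by auto
qed

lemma smult_minus_scalar:
  assumes "r \<in> carrier R" "x \<in> carrier M" shows "(\<ominus> r) \<odot>\<^bsub>M\<^esub> x = \<ominus>\<^bsub>M\<^esub> (r \<odot>\<^bsub>M\<^esub> x)"
proof -
  have "(\<ominus> r) \<odot>\<^bsub>M\<^esub> x \<oplus>\<^bsub>M\<^esub> r \<odot>\<^bsub>M\<^esub> x = \<zero>\<^bsub>M\<^esub>"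
    using act_add_scalar[of "\<ominus> r" r x] assms by (simp add: R.l_neg smult_zero_scalar)
  then show ?thesis
    using assms act_closed M.minus_equality by (metis R.a_inv_closed)
qed

end

context
  fixes R :: "('r, 'z) ring_scheme" and M :: "('r, 'm) module"
  assumes right_module: "right_module R M"
begin

interpretation right_module R M by (rule right_module)

lemma lin_comb_Nil [simp]: "lin_comb M [] rs = \<zero>\<^bsub>M\<^esub>"
  by (simp add: lin_comb_def)

lemma lin_comb_Cons:
  assumes "x \<in> carrier M" "set xs \<subseteq> carrier M" "r \<in> carrier R" "set rs \<subseteq> carrier R"
    and "length rs = length xs"
  shows "lin_comb M (x # xs) (r # rs) = r \<odot>\<^bsub>M\<^esub> x \<oplus>\<^bsub>M\<^esub> lin_comb M xs rs"
proof -
  define F where "F = (\<lambda>i. ((r # rs) ! i) \<odot>\<^bsub>M\<^esub> ((x # xs) ! i))"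
  have tail: "F (Suc i) = (rs ! i) \<odot>\<^bsub>M\<^esub> (xs ! i)" for i
    by (simp add: F_def)
  have nth: "rs ! i \<in> carrier R \<and> xs ! i \<in> carrier M" if "i < length xs" for i
    using that assms by (metis nth_mem subsetD)
  have cl: "F (Suc i) \<in> carrier M" if "i < length xs" for i
    unfolding tail using nth[OF that] by (simp add: act_closed)
  have F0: "F 0 = r \<odot>\<^bsub>M\<^esub> x" by (simp add: F_def)
  have "lin_comb M (x # xs) (r # rs) = finsum M F {..<Suc (length xs)}"
    by (simp add: lin_comb_def F_def)
  also have "\<dots> = finsum M F (insert 0 (Suc ` {..<length xs}))"
    by (simp add: lessThan_Suc_eq_insert_0)
  also have "\<dots> = F 0 \<oplus>\<^bsub>M\<^esub> finsum M F (Suc ` {..<length xs})"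
    by (rule M.finsum_insert) (use cl F0 assms act_closed in auto)
  also have "finsum M F (Suc ` {..<length xs}) = (\<Oplus>\<^bsub>M\<^esub>i\<in>{..<length xs}. F (Suc i))"
    by (rule M.finsum_reindex) (use cl in auto)
  also have "\<dots> = lin_comb M xs rs"
    by (simp add: lin_comb_def tail)
  finally show ?thesis by (simp add: F0)
qed

lemma lin_comb_closed:
  assumes "length rs = length xs" "set xs \<subseteq> carrier M" "set rs \<subseteq> carrier R"
  shows "lin_comb M xs rs \<in> carrier M"
  using assms
  by (induction rs xs rule: list_induct2) (auto simp: lin_comb_Cons act_closed)

lemma lin_comb_append:
  assumes "length rs = length xs" "set xs \<subseteq> carrier M" "set rs \<subseteq> carrier R"
    and "length ss = length ys" "set ys \<subseteq> carrier M" "set ss \<subseteq> carrier R"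
  shows "lin_comb M (xs @ ys) (rs @ ss) = lin_comb M xs rs \<oplus>\<^bsub>M\<^esub> lin_comb M ys ss"
  using assms
  by (induction rs xs rule: list_induct2)
     (auto simp: lin_comb_Cons lin_comb_closed act_closed M.a_assoc)

lemma lin_comb_zero_scalars:
  assumes "set xs \<subseteq> carrier M" "length xs = n"
  shows "lin_comb M xs (replicate n \<zero>\<^bsub>R\<^esub>) = \<zero>\<^bsub>M\<^esub>"
  using assms
proof (induction xs arbitrary: n)
  case (Cons x xs)
  have "set (replicate (length xs) \<zero>\<^bsub>R\<^esub>) \<subseteq> carrier R" by auto
  with Cons show ?case by (auto simp: lin_comb_Cons smult_zero_scalar)
qed simp

lemma lin_comb_minus_scalars:
  assumes "length rs = length xs" "set xs \<subseteq> carrier M" "set rs \<subseteq> carrier R"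
  shows "lin_comb M xs (map (\<lambda>r. \<ominus>\<^bsub>R\<^esub> r) rs) = \<ominus>\<^bsub>M\<^esub> lin_comb M xs rs"
  using assms
proof (induction rs xs rule: list_induct2)
  case (Cons r rs x xs)
  have "set (map (\<lambda>r. \<ominus>\<^bsub>R\<^esub> r) rs) \<subseteq> carrier R" using Cons.prems by auto
  with Cons show ?case
    by (auto simp: lin_comb_Cons smult_minus_scalar M.minus_add lin_comb_closed act_closed)
next
  case Nil
  have "\<ominus>\<^bsub>M\<^esub> \<zero>\<^bsub>M\<^esub> = \<zero>\<^bsub>M\<^esub>" by (rule M.minus_equality) simp_all
  then show ?case by (simp only: lin_comb_Nil list.map)
qed

lemma set_map2_add_closed:
  assumes "set xs \<subseteq> carrier M" "set ys \<subseteq> carrier M"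
  shows "set (map2 (\<lambda>x y. x \<oplus>\<^bsub>M\<^esub> y) xs ys) \<subseteq> carrier M"
  using assms by (auto dest: set_zip_leftD set_zip_rightD)

lemma lin_comb_add:
  assumes "length rs = length xs" "length xs = length ys"
    and "set xs \<subseteq> carrier M" "set ys \<subseteq> carrier M" "set rs \<subseteq> carrier R"
  shows "lin_comb M (map2 (\<lambda>x y. x \<oplus>\<^bsub>M\<^esub> y) xs ys) rs
    = lin_comb M xs rs \<oplus>\<^bsub>M\<^esub> lin_comb M ys rs"
  using assms
proof (induction rs xs ys rule: list_induct3)
  case (Cons r rs x xs y ys)
  have "set (map2 (\<lambda>x y. x \<oplus>\<^bsub>M\<^esub> y) xs ys) \<subseteq> carrier M"
    using Cons.prems set_map2_add_closed by simp
  with Cons show ?case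
    by (auto simp: lin_comb_Cons act_add lin_comb_closed act_closed M.add.m_ac)
qed simp

end

lemma linear_maps_zero:
  assumes "right_module R M" "right_module R N" "g \<in> linear_maps R M N"
  shows "g \<zero>\<^bsub>M\<^esub> = \<zero>\<^bsub>N\<^esub>"
proof -
  interpret M: right_module R M by fact
  interpret N: right_module R N by fact
  have g0: "g \<zero>\<^bsub>M\<^esub> \<in> carrier N" using assms(3) by (auto simp: linear_maps_def)
  have "g (\<zero>\<^bsub>M\<^esub> \<oplus>\<^bsub>M\<^esub> \<zero>\<^bsub>M\<^esub>) = g \<zero>\<^bsub>M\<^esub> \<oplus>\<^bsub>N\<^esub> g \<zero>\<^bsub>M\<^esub>"
    using assms(3) M.zero_closed unfolding linear_maps_def by blast
  then have "g \<zero>\<^bsub>M\<^esub> \<oplus>\<^bsub>N\<^esub> g \<zero>\<^bsub>M\<^esub> = g \<zero>\<^bsub>M\<^esub>" by simp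
  then show ?thesis using g0 by (simp add: N.M.add.l_cancel_one)
qed

lemma linear_maps_lin_comb:
  assumes "right_module R M" "right_module R N" "g \<in> linear_maps R M N"
    and "length rs = length xs" "set xs \<subseteq> carrier M" "set rs \<subseteq> carrier R"
  shows "g (lin_comb M xs rs) = lin_comb N (map g xs) rs"
proof -
  interpret M: right_module R M by fact
  interpret N: right_module R N by fact
  have g: "x \<in> carrier M \<Longrightarrow> g x \<in> carrier N"
    "x \<in> carrier M \<Longrightarrow> y \<in> carrier M \<Longrightarrow> g (x \<oplus>\<^bsub>M\<^esub> y) = g x \<oplus>\<^bsub>N\<^esub> g y"
    "r \<in> carrier R \<Longrightarrow> x \<in> carrier M \<Longrightarrow> g (r \<odot>\<^bsub>M\<^esub> x) = r \<odot>\<^bsub>N\<^esub> g x" for x y r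
    using assms(3) by (auto simp: linear_maps_def)
  show ?thesis
    using assms(4-6)
  proof (induction rs xs rule: list_induct2)
    case Nil
    then show ?case using assms by (simp add: lin_comb_Nil linear_maps_zero)
  next
    case (Cons r rs x xs)
    have "set (map g xs) \<subseteq> carrier N" using Cons.prems g by auto
    with Cons show ?case
      using assms(1,2)
      by (simp add: lin_comb_Cons lin_comb_closed g M.act_closed)
  qed
qed

section \<open>Solution sets of pp formulas\<close>

lemma pp_solE:
  assumes "xs \<in> pp_sol M \<phi>"
  obtains ys where "length xs = arity \<phi>" "set xs \<subseteq> carrier M"
    and "length ys = bound \<phi>" "set ys \<subseteq> carrier M"
    and "\<And>r s. (r, s) \<in> set (eqns \<phi>) \<Longrightarrow> lin_comb M xs r \<oplus>\<^bsub>M\<^esub> lin_comb M ys s = \<zero>\<^bsub>M\<^esub>"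
  using assms unfolding pp_sol_def by fast

lemma pp_sol_add_closed:
  assumes RM: "right_module R M" and pp: "is_pp R \<phi>"
    and "xs \<in> pp_sol M \<phi>" "xs' \<in> pp_sol M \<phi>"
  shows "map2 (\<lambda>x y. x \<oplus>\<^bsub>M\<^esub> y) xs xs' \<in> pp_sol M \<phi>"
proof -
  interpret right_module R M by fact
  from assms(3) obtain ys where ys: "length ys = bound \<phi>" "set ys \<subseteq> carrier M"
    "\<And>r s. (r, s) \<in> set (eqns \<phi>) \<Longrightarrow> lin_comb M xs r \<oplus>\<^bsub>M\<^esub> lin_comb M ys s = \<zero>\<^bsub>M\<^esub>"
    and xs: "length xs = arity \<phi>" "set xs \<subseteq> carrier M"
    by (elim pp_solE) blast
  from assms(4) obtain ys' where ys': "length ys' = bound \<phi>" "set ys' \<subseteq> carrier M"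
    "\<And>r s. (r, s) \<in> set (eqns \<phi>) \<Longrightarrow> lin_comb M xs' r \<oplus>\<^bsub>M\<^esub> lin_comb M ys' s = \<zero>\<^bsub>M\<^esub>"
    and xs': "length xs' = arity \<phi>" "set xs' \<subseteq> carrier M"
    by (elim pp_solE) blast
  let ?x = "map2 (\<lambda>x y. x \<oplus>\<^bsub>M\<^esub> y) xs xs'" and ?y = "map2 (\<lambda>x y. x \<oplus>\<^bsub>M\<^esub> y) ys ys'"
  have "lin_comb M ?x r \<oplus>\<^bsub>M\<^esub> lin_comb M ?y s = \<zero>\<^bsub>M\<^esub>" if rs: "(r, s) \<in> set (eqns \<phi>)" for r s
  proof -
    have l: "length r = arity \<phi>" "set r \<subseteq> carrier R" "length s = bound \<phi>" "set s \<subseteq> carrier R"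
      using pp rs by (auto simp: is_pp_def)
    have cl: "lin_comb M xs r \<in> carrier M" "lin_comb M ys s \<in> carrier M"
      "lin_comb M xs' r \<in> carrier M" "lin_comb M ys' s \<in> carrier M"
      using l xs ys xs' ys' by (auto intro!: lin_comb_closed[OF RM])
    have "lin_comb M ?x r \<oplus>\<^bsub>M\<^esub> lin_comb M ?y s
      = (lin_comb M xs r \<oplus>\<^bsub>M\<^esub> lin_comb M xs' r) \<oplus>\<^bsub>M\<^esub> (lin_comb M ys s \<oplus>\<^bsub>M\<^esub> lin_comb M ys' s)"
      using l xs ys xs' ys' by (simp add: lin_comb_add[OF RM])
    also have "\<dots> = (lin_comb M xs r \<oplus>\<^bsub>M\<^esub> lin_comb M ys s) \<oplus>\<^bsub>M\<^esub> (lin_comb M xs' r \<oplus>\<^bsub>M\<^esub> lin_comb M ys' s)"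
      using cl by (simp add: M.add.m_ac)
    also have "\<dots> = \<zero>\<^bsub>M\<^esub>" using ys(3)[OF rs] ys'(3)[OF rs] by simp
    finally show ?thesis .
  qed
  moreover have "set ?x \<subseteq> carrier M" "set ?y \<subseteq> carrier M"
    using xs ys xs' ys' set_map2_add_closed[OF RM] by blast+
  ultimately show ?thesis
    unfolding pp_sol_def using xs xs' ys ys' by (auto intro!: exI[of _ ?y])
qed

lemma pp_sol_linear_image:
  assumes RM: "right_module R M" and RN: "right_module R N" and g: "g \<in> linear_maps R M N"
    and pp: "is_pp R \<phi>" and "xs \<in> pp_sol M \<phi>"
  shows "map g xs \<in> pp_sol N \<phi>"
proof -
  interpret right_module R M by fact
  from assms(5) obtain ys where ys: "length ys = bound \<phi>" "set ys \<subseteq> carrier M"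
    "\<And>r s. (r, s) \<in> set (eqns \<phi>) \<Longrightarrow> lin_comb M xs r \<oplus>\<^bsub>M\<^esub> lin_comb M ys s = \<zero>\<^bsub>M\<^esub>"
    and xs: "length xs = arity \<phi>" "set xs \<subseteq> carrier M"
    by (elim pp_solE) blast
  have "lin_comb N (map g xs) r \<oplus>\<^bsub>N\<^esub> lin_comb N (map g ys) s = \<zero>\<^bsub>N\<^esub>"
    if rs: "(r, s) \<in> set (eqns \<phi>)" for r s
  proof -
    have l: "length r = arity \<phi>" "set r \<subseteq> carrier R" "length s = bound \<phi>" "set s \<subseteq> carrier R"
      using pp rs by (auto simp: is_pp_def)
    have "lin_comb N (map g xs) r \<oplus>\<^bsub>N\<^esub> lin_comb N (map g ys) s
      = g (lin_comb M xs r) \<oplus>\<^bsub>N\<^esub> g (lin_comb M ys s)"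
      using l xs ys by (simp add: linear_maps_lin_comb[OF RM RN g])
    also have "\<dots> = g (lin_comb M xs r \<oplus>\<^bsub>M\<^esub> lin_comb M ys s)"
      using l xs ys g lin_comb_closed[OF RM] by (auto simp: linear_maps_def)
    finally show ?thesis using ys(3)[OF rs] linear_maps_zero[OF RM RN g] by simp
  qed
  moreover have "set (map g xs) \<subseteq> carrier N" "set (map g ys) \<subseteq> carrier N"
    using xs ys g by (auto simp: linear_maps_def)
  ultimately show ?thesis
    unfolding pp_sol_def using xs ys by (auto intro!: exI[of _ "map g ys"])
qed

text \<open>The sum of two pp formulas in the same free variables: x satisfies it if some u satisfies the
  first formula and x - u satisfies the second one. The quantified variables are u, followed by
  those of the first and those of the second formula. As x - u is determined by x and u, it is not
  quantified; an equation on it has coefficients r on x and -r on u.\<close>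

definition pp_sum :: "('r, 'z) ring_scheme \<Rightarrow> 'r pp \<Rightarrow> 'r pp \<Rightarrow> 'r pp" where
  "pp_sum R \<phi> \<psi> = PP (arity \<phi>) (arity \<phi> + bound \<phi> + bound \<psi>)
     (map (\<lambda>(r, s). (replicate (arity \<phi>) \<zero>\<^bsub>R\<^esub>, r @ s @ replicate (bound \<psi>) \<zero>\<^bsub>R\<^esub>)) (eqns \<phi>) @
      map (\<lambda>(r, s). (r, map (\<lambda>c. \<ominus>\<^bsub>R\<^esub> c) r @ replicate (bound \<phi>) \<zero>\<^bsub>R\<^esub> @ s)) (eqns \<psi>))"

lemma arity_pp_sum [simp]: "arity (pp_sum R \<phi> \<psi>) = arity \<phi>"
  by (simp add: pp_sum_def)

lemma is_pp_pp_sum: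
  assumes "ring R" "is_pp R \<phi>" "is_pp R \<psi>" "arity \<phi> = arity \<psi>"
  shows "is_pp R (pp_sum R \<phi> \<psi>)"
proof -
  interpret ring R by fact
  show ?thesis
    using assms(2-) unfolding is_pp_def pp_sum_def by (fastforce simp: subset_iff)
qed

lemma pp_sol_pp_sum:
  assumes RM: "right_module R M" and pp: "is_pp R \<phi>" "is_pp R \<psi>" and ar: "arity \<phi> = arity \<psi>"
  shows "pp_sol M (pp_sum R \<phi> \<psi>)
    = {map2 (\<lambda>x y. x \<oplus>\<^bsub>M\<^esub> y) u v | u v. u \<in> pp_sol M \<phi> \<and> v \<in> pp_sol M \<psi>}"
    (is "?L = ?S")
proof -
  interpret right_module R M by fact
  let ?n = "arity \<phi>"
  note [simp] = lin_comb_closed[OF RM] lin_comb_append[OF RM] lin_comb_zero_scalars[OF RM]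
    lin_comb_minus_scalars[OF RM]
  have zeros [simp]: "set (replicate k \<zero>\<^bsub>R\<^esub>) \<subseteq> carrier R" for k by auto
  have neg [simp]: "set (map (\<lambda>c. \<ominus>\<^bsub>R\<^esub> c) r) \<subseteq> carrier R" if "set r \<subseteq> carrier R" for r
    using that by auto
  have l1: "length r = ?n" "set r \<subseteq> carrier R" "length s = bound \<phi>" "set s \<subseteq> carrier R"
    if "(r, s) \<in> set (eqns \<phi>)" for r s using pp(1) that by (auto simp: is_pp_def)
  have l2: "length r = ?n" "set r \<subseteq> carrier R" "length s = bound \<psi>" "set s \<subseteq> carrier R"
    if "(r, s) \<in> set (eqns \<psi>)" for r s using pp(2) that ar by (auto simp: is_pp_def)
  \<comment> \<open>The equations of the sum reduce to those of the first formula for u and, when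
    \<open>x = u + v\<close>, to those of the second formula for v.\<close>
  have eq1: "lin_comb M x (replicate ?n \<zero>\<^bsub>R\<^esub>) \<oplus>\<^bsub>M\<^esub>
      lin_comb M (u @ y @ z) (r @ s @ replicate (bound \<psi>) \<zero>\<^bsub>R\<^esub>)
      = lin_comb M u r \<oplus>\<^bsub>M\<^esub> lin_comb M y s"
    if "length x = ?n" "set x \<subseteq> carrier M" "length u = ?n" "set u \<subseteq> carrier M"
      "length y = bound \<phi>" "set y \<subseteq> carrier M" "length z = bound \<psi>" "set z \<subseteq> carrier M"
      "(r, s) \<in> set (eqns \<phi>)" for x u y z r s
    using that l1[OF that(9)] by simp
  have eq2: "lin_comb M (map2 (\<lambda>x y. x \<oplus>\<^bsub>M\<^esub> y) u v) r \<oplus>\<^bsub>M\<^esub>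
      lin_comb M (u @ y @ z) (map (\<lambda>c. \<ominus>\<^bsub>R\<^esub> c) r @ replicate (bound \<phi>) \<zero>\<^bsub>R\<^esub> @ s)
      = lin_comb M v r \<oplus>\<^bsub>M\<^esub> lin_comb M z s"
    if "length v = ?n" "set v \<subseteq> carrier M" "length u = ?n" "set u \<subseteq> carrier M"
      "length y = bound \<phi>" "set y \<subseteq> carrier M" "length z = bound \<psi>" "set z \<subseteq> carrier M"
      "(r, s) \<in> set (eqns \<psi>)" for v u y z r s
  proof -
    have cl: "lin_comb M u r \<in> carrier M" "lin_comb M v r \<in> carrier M" "lin_comb M z s \<in> carrier M"
      using that l2[OF that(9)] by auto
    have "(lin_comb M u r \<oplus>\<^bsub>M\<^esub> lin_comb M v r) \<oplus>\<^bsub>M\<^esub> (\<ominus>\<^bsub>M\<^esub> lin_comb M u r \<oplus>\<^bsub>M\<^esub> lin_comb M z s)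
      = (\<ominus>\<^bsub>M\<^esub> lin_comb M u r \<oplus>\<^bsub>M\<^esub> lin_comb M u r) \<oplus>\<^bsub>M\<^esub> (lin_comb M v r \<oplus>\<^bsub>M\<^esub> lin_comb M z s)"
      using cl by (simp add: M.add.m_ac del: M.l_neg M.r_neg)
    moreover have "lin_comb M (u @ y @ z)
        (map (\<lambda>c. \<ominus>\<^bsub>R\<^esub> c) r @ replicate (bound \<phi>) \<zero>\<^bsub>R\<^esub> @ s)
      = \<ominus>\<^bsub>M\<^esub> lin_comb M u r \<oplus>\<^bsub>M\<^esub> lin_comb M z s"
      using that l2[OF that(9)] neg[OF l2(2)[OF that(9)]] cl
      by (simp del: set_map)
    ultimately show ?thesis
      using that l2[OF that(9)] cl by (simp add: lin_comb_add[OF RM] M.l_neg)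
  qed
  show ?thesis
  proof (intro equalityI subsetI)
    fix x assume "x \<in> ?L"
    then obtain w where x: "length x = ?n" "set x \<subseteq> carrier M"
      and w: "length w = ?n + bound \<phi> + bound \<psi>" "set w \<subseteq> carrier M"
      and eqs: "\<And>r s. (r, s) \<in> set (eqns (pp_sum R \<phi> \<psi>)) \<Longrightarrow>
        lin_comb M x r \<oplus>\<^bsub>M\<^esub> lin_comb M w s = \<zero>\<^bsub>M\<^esub>"
      by (elim pp_solE) (simp add: pp_sum_def)
    define u where "u = take ?n w"
    define y where "y = take (bound \<phi>) (drop ?n w)"
    define z where "z = drop (bound \<phi>) (drop ?n w)"
    define v where "v = map2 (\<lambda>x u. x \<ominus>\<^bsub>M\<^esub> u) x u"
    have w_eq: "w = u @ y @ z" by (simp only: u_def y_def z_def append_take_drop_id)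
    have len: "length u = ?n" "length y = bound \<phi>" "length z = bound \<psi>" "length v = ?n"
      using w x by (simp_all add: u_def y_def z_def v_def)
    have cl: "set u \<subseteq> carrier M" "set y \<subseteq> carrier M" "set z \<subseteq> carrier M"
      using w(2) w_eq by auto
    have nth: "x ! i \<in> carrier M" "u ! i \<in> carrier M" if "i < ?n" for i
      using that x cl len by (metis nth_mem subsetD)+
    have clv: "set v \<subseteq> carrier M"
      using x cl unfolding v_def
      by (auto simp: M.minus_closed subset_iff dest!: set_zip_leftD set_zip_rightD elim!: in_set_zipE)
    have x_eq: "x = map2 (\<lambda>x y. x \<oplus>\<^bsub>M\<^esub> y) u v"
    proof (rule nth_equalityI)
      fix i assume "i < length x"
      then have i: "i < ?n" using x by simp
      have "u ! i \<oplus>\<^bsub>M\<^esub> (x ! i \<ominus>\<^bsub>M\<^esub> u ! i) = x ! i"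
        using nth[OF i] by (metis M.a_inv_closed M.minus_eq M.a_comm M.a_assoc M.l_neg M.r_zero)
      then show "x ! i = map2 (\<lambda>x y. x \<oplus>\<^bsub>M\<^esub> y) u v ! i"
        using i len x by (simp add: v_def)
    qed (use len x in simp)
    have "u \<in> pp_sol M \<phi>"
    proof -
      have "lin_comb M u r \<oplus>\<^bsub>M\<^esub> lin_comb M y s = \<zero>\<^bsub>M\<^esub>" if "(r, s) \<in> set (eqns \<phi>)" for r s
        using eqs[of "replicate ?n \<zero>\<^bsub>R\<^esub>" "r @ s @ replicate (bound \<psi>) \<zero>\<^bsub>R\<^esub>"] that
          eq1[OF x len(1) cl(1) len(2) cl(2) len(3) cl(3) that] w_eq
        by (force simp: pp_sum_def)
      then show ?thesis unfolding pp_sol_def using len cl by auto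
    qed
    moreover have "v \<in> pp_sol M \<psi>"
    proof -
      have "lin_comb M v r \<oplus>\<^bsub>M\<^esub> lin_comb M z s = \<zero>\<^bsub>M\<^esub>" if "(r, s) \<in> set (eqns \<psi>)" for r s
        using eqs[of r "map (\<lambda>c. \<ominus>\<^bsub>R\<^esub> c) r @ replicate (bound \<phi>) \<zero>\<^bsub>R\<^esub> @ s"] that
          eq2[OF len(4) clv len(1) cl(1) len(2) cl(2) len(3) cl(3) that] w_eq x_eq
        by (force simp: pp_sum_def)
      then show ?thesis unfolding pp_sol_def using len cl clv ar by auto
    qed
    ultimately show "x \<in> ?S" using x_eq by blast
  next
    fix x assume "x \<in> ?S"
    then obtain u v where x_eq: "x = map2 (\<lambda>x y. x \<oplus>\<^bsub>M\<^esub> y) u v"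
      and uv: "u \<in> pp_sol M \<phi>" "v \<in> pp_sol M \<psi>" by blast
    from uv(1) obtain y where y: "length y = bound \<phi>" "set y \<subseteq> carrier M"
      "\<And>r s. (r, s) \<in> set (eqns \<phi>) \<Longrightarrow> lin_comb M u r \<oplus>\<^bsub>M\<^esub> lin_comb M y s = \<zero>\<^bsub>M\<^esub>"
      and u: "length u = ?n" "set u \<subseteq> carrier M"
      by (elim pp_solE) blast
    from uv(2) obtain z where z: "length z = bound \<psi>" "set z \<subseteq> carrier M"
      "\<And>r s. (r, s) \<in> set (eqns \<psi>) \<Longrightarrow> lin_comb M v r \<oplus>\<^bsub>M\<^esub> lin_comb M z s = \<zero>\<^bsub>M\<^esub>"
      and v: "length v = ?n" "set v \<subseteq> carrier M"
      unfolding ar by (elim pp_solE) blast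
    have x: "length x = ?n" "set x \<subseteq> carrier M"
      using u v x_eq set_map2_add_closed[OF RM] by auto
    have eqs: "lin_comb M x r \<oplus>\<^bsub>M\<^esub> lin_comb M (u @ y @ z) s = \<zero>\<^bsub>M\<^esub>"
      if "(r, s) \<in> set (eqns (pp_sum R \<phi> \<psi>))" for r s
    proof -
      consider r' s' where "(r', s') \<in> set (eqns \<phi>)" "r = replicate ?n \<zero>\<^bsub>R\<^esub>"
          "s = r' @ s' @ replicate (bound \<psi>) \<zero>\<^bsub>R\<^esub>"
        | s' where "(r, s') \<in> set (eqns \<psi>)"
          "s = map (\<lambda>c. \<ominus>\<^bsub>R\<^esub> c) r @ replicate (bound \<phi>) \<zero>\<^bsub>R\<^esub> @ s'"
        using \<open>(r, s) \<in> _\<close> by (auto simp: pp_sum_def)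
      then show ?thesis
      proof cases
        case 1
        show ?thesis unfolding 1(2,3) eq1[OF x u y(1,2) z(1,2) 1(1)] by (rule y(3)[OF 1(1)])
      next
        case 2
        show ?thesis unfolding x_eq 2(2) eq2[OF v u y(1,2) z(1,2) 2(1)] by (rule z(3)[OF 2(1)])
      qed
    qed
    have "length (u @ y @ z) = bound (pp_sum R \<phi> \<psi>)" "set (u @ y @ z) \<subseteq> carrier M"
      using u y(1,2) z(1,2) by (auto simp: pp_sum_def)
    then show "x \<in> ?L"
      unfolding pp_sol_def arity_pp_sum using x eqs by blast
  qed
qed

section \<open>Biendomorphisms of strictly atomic modules\<close>

text \<open>Let the formula generate the pp-type of the tuple. Its solutions include the images of the
  tuple because linear maps preserve pp formulas, and strict atomicity says that there are no
  others.\<close>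

lemma strictly_atomic_orbit:
  assumes RM: "right_module R M" and "M \<in> \<D>" and sa: "strictly_atomic R \<D> M"
    and a: "set a \<subseteq> carrier M"
  shows "\<exists>\<phi>. is_pp R \<phi> \<and> arity \<phi> = length a \<and> pp_sol M \<phi> = {map g a | g. g \<in> linear_maps R M M}"
proof -
  from sa a obtain \<phi> where \<phi>: "is_pp R \<phi>" "pp_type R M a = pp_filter R \<D> \<phi>"
    unfolding strictly_atomic_def by meson
  have "\<phi> \<in> pp_filter R \<D> \<phi>" using \<phi>(1) by (simp add: pp_filter_def pp_le_def)
  then have sol: "a \<in> pp_sol M \<phi>" using \<phi>(2) by (auto simp: pp_type_def)
  have "\<exists>g\<in>linear_maps R M M. map g a = b" if "b \<in> pp_sol M \<phi>" for b
    using sa a \<phi> that \<open>M \<in> \<D>\<close> unfolding strictly_atomic_def by meson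
  then have "pp_sol M \<phi> = {map g a | g. g \<in> linear_maps R M M}"
    using pp_sol_linear_image[OF RM RM _ \<phi>(1) sol] by blast
  moreover have "arity \<phi> = length a" using sol by (simp add: pp_sol_def)
  ultimately show ?thesis using \<phi>(1) by blast
qed

lemma finsum_eval_module: "finsum (eval_module M) f A = finsum M f A"
  by (simp add: eval_module_def finsum_def finprod_def)

lemma eval_module_simps [simp]:
  "carrier (eval_module M) = carrier M" "add (eval_module M) = add M"
  "zero (eval_module M) = zero M" "f \<odot>\<^bsub>eval_module M\<^esub> x = f x"
  by (simp_all add: eval_module_def)

text \<open>Strict atomicity provides arbitrary linear maps, whereas endomorphisms are extensional.\<close>

lemma linear_maps_restrict_End_ring:
  assumes "right_module R M" "g \<in> linear_maps R M M"
  shows "restrict g (carrier M) \<in> carrier (End_ring R M)"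
proof -
  interpret right_module R M by fact
  show ?thesis using assms(2)
    by (auto simp: End_ring_def linear_maps_def act_closed)
qed

lemma carrier_Biend_iff:
  "f \<in> carrier (Biend R M) \<longleftrightarrow> f \<in> carrier M \<rightarrow>\<^sub>E carrier M \<and>
    (\<forall>x\<in>carrier M. \<forall>y\<in>carrier M. f (x \<oplus>\<^bsub>M\<^esub> y) = f x \<oplus>\<^bsub>M\<^esub> f y) \<and>
    (\<forall>g\<in>carrier (End_ring R M). \<forall>x\<in>carrier M. f (g x) = g (f x))"
  by (auto simp: Biend_def opposite_ring_def End_ring_def[of "End_ring R M"] linear_maps_def
    PiE_def)

lemma Biend_eqI:
  assumes "carrier (definable_scalars R M) = carrier (Biend R M)"
  shows "definable_scalars R M = Biend R M"
  using assms
  by (simp add: definable_scalars_def Biend_def opposite_ring_def End_ring_def)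

text \<open>The graph is closed under addition and under endomorphisms, and it is the graph of a function;
  so the sum of two of its points, or the image of one, has its second entry forced.\<close>

lemma definable_scalar_in_Biend:
  assumes RM: "right_module R M" and f: "f \<in> carrier (definable_scalars R M)"
  shows "f \<in> carrier (Biend R M)"
proof -
  interpret right_module R M by fact
  from f obtain \<rho> where \<rho>: "is_pp R \<rho>" "{[x, f x] | x. x \<in> carrier M} = pp_sol M \<rho>"
    and fM: "f \<in> carrier M \<rightarrow>\<^sub>E carrier M"
    by (auto simp: definable_scalars_def)
  have graph: "[x, y] \<in> pp_sol M \<rho> \<longleftrightarrow> x \<in> carrier M \<and> y = f x" for x y
    unfolding \<rho>(2)[symmetric] by auto
  have "f (x \<oplus>\<^bsub>M\<^esub> y) = f x \<oplus>\<^bsub>M\<^esub> f y" if "x \<in> carrier M" "y \<in> carrier M" for x y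
    using pp_sol_add_closed[OF RM \<rho>(1), of "[x, f x]" "[y, f y]"] that by (simp add: graph)
  moreover have "f (g x) = g (f x)" if "g \<in> carrier (End_ring R M)" "x \<in> carrier M" for g x
    using pp_sol_linear_image[OF RM RM _ \<rho>(1), of g "[x, f x]"] that
    by (simp add: graph End_ring_def)
  ultimately show ?thesis using fM by (simp add: carrier_Biend_iff)
qed

text \<open>For one element a, the pp-definable orbit of (a, f a) already lies on the graph of f, as f
  commutes with endomorphisms. The sum of these orbits over A stays on the graph, as f is additive,
  and lies over the submodule generated by A.\<close>

lemma biendomorphism_graph_pp_definable:
  assumes RM: "right_module R M" and "M \<in> \<D>" and sa: "strictly_atomic R \<D> M"
    and f: "f \<in> carrier (Biend R M)" and "finite A" "A \<subseteq> carrier M"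
  shows "\<exists>\<rho>. is_pp R \<rho> \<and> arity \<rho> = 2 \<and> pp_sol M \<rho> =
    {[x, f x] | x. \<exists>c \<in> A \<rightarrow> carrier (End_ring R M). x = (\<Oplus>\<^bsub>M\<^esub> a\<in>A. c a a)}"
proof -
  interpret right_module R M by fact
  let ?E = "carrier (End_ring R M)"
  have fM: "\<And>x. x \<in> carrier M \<Longrightarrow> f x \<in> carrier M"
    and fadd: "\<And>x y. x \<in> carrier M \<Longrightarrow> y \<in> carrier M \<Longrightarrow> f (x \<oplus>\<^bsub>M\<^esub> y) = f x \<oplus>\<^bsub>M\<^esub> f y"
    and fcomm: "\<And>g x. g \<in> ?E \<Longrightarrow> x \<in> carrier M \<Longrightarrow> f (g x) = g (f x)"
    using f by (auto simp: carrier_Biend_iff)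
  have EM: "g x \<in> carrier M" if "g \<in> ?E" "x \<in> carrier M" for g x
    using that by (auto simp: End_ring_def linear_maps_def)
  have cyclic: "\<exists>\<phi>. is_pp R \<phi> \<and> arity \<phi> = 2 \<and> pp_sol M \<phi> = {[g a, f (g a)] | g. g \<in> ?E}"
    if a: "a \<in> carrier M" for a
  proof -
    have "{map g [a, f a] | g. g \<in> linear_maps R M M} = {[g a, f (g a)] | g. g \<in> ?E}"
    proof (intro equalityI subsetI)
      fix x assume "x \<in> {map g [a, f a] | g. g \<in> linear_maps R M M}"
      then obtain g where g: "g \<in> linear_maps R M M" "x = [g a, g (f a)]" by auto
      let ?h = "restrict g (carrier M)"
      have h: "?h \<in> ?E" by (rule linear_maps_restrict_End_ring[OF RM g(1)])
      have "x = [?h a, f (?h a)]" using fcomm[OF h a] g(2) a fM by simp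
      then show "x \<in> {[g a, f (g a)] | g. g \<in> ?E}" using h by blast
    next
      fix x assume "x \<in> {[g a, f (g a)] | g. g \<in> ?E}"
      then obtain g where g: "g \<in> ?E" "x = [g a, g (f a)]" using fcomm a by auto
      then have "g \<in> linear_maps R M M" "x = map g [a, f a]" by (auto simp: End_ring_def)
      then show "x \<in> {map g [a, f a] | g. g \<in> linear_maps R M M}" by blast
    qed
    moreover have "set [a, f a] \<subseteq> carrier M" using a fM by simp
    ultimately show ?thesis
      using strictly_atomic_orbit[OF RM \<open>M \<in> \<D>\<close> sa, of "[a, f a]"] by (simp add: numeral_2_eq_2)
  qed
  show ?thesis
    using assms(5,6)
  proof (induction A)
    case empty
    \<comment> \<open>Endomorphisms fix 0, so the orbit of \<open>(0, f 0)\<close> is this point alone.\<close>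
    have "restrict (\<lambda>x. x) (carrier M) \<in> ?E"
      by (rule linear_maps_restrict_End_ring[OF RM]) (auto simp: linear_maps_def)
    then have "?E \<noteq> {}" by blast
    moreover have "g \<zero>\<^bsub>M\<^esub> = \<zero>\<^bsub>M\<^esub>" if "g \<in> ?E" for g
      using that linear_maps_zero[OF RM RM] by (simp add: End_ring_def)
    then have "{[g \<zero>\<^bsub>M\<^esub>, f (g \<zero>\<^bsub>M\<^esub>)] | g. g \<in> ?E} = {[\<zero>\<^bsub>M\<^esub>, f \<zero>\<^bsub>M\<^esub>] | g. g \<in> ?E}"
      by (metis (no_types, lifting))
    ultimately have "{[g \<zero>\<^bsub>M\<^esub>, f (g \<zero>\<^bsub>M\<^esub>)] | g. g \<in> ?E} = {[\<zero>\<^bsub>M\<^esub>, f \<zero>\<^bsub>M\<^esub>]}" by auto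
    then show ?case using cyclic[of "\<zero>\<^bsub>M\<^esub>"] by simp
  next
    case (insert a A)
    have a: "a \<in> carrier M" and A: "A \<subseteq> carrier M" using insert.prems by auto
    from insert.IH[OF A] obtain \<psi> where \<psi>: "is_pp R \<psi>" "arity \<psi> = 2" "pp_sol M \<psi> =
      {[x, f x] | x. \<exists>c \<in> A \<rightarrow> ?E. x = (\<Oplus>\<^bsub>M\<^esub> a\<in>A. c a a)}" by blast
    from cyclic[OF a] obtain \<phi> where \<phi>: "is_pp R \<phi>" "arity \<phi> = 2"
      "pp_sol M \<phi> = {[g a, f (g a)] | g. g \<in> ?E}" by blast
    have clA: "(\<Oplus>\<^bsub>M\<^esub> b\<in>A. c b b) \<in> carrier M" if "c \<in> A \<rightarrow> ?E" for c
      by (rule M.finsum_closed) (use that A EM in auto)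
    have ins: "(\<Oplus>\<^bsub>M\<^esub> b\<in>insert a A. c b b) = c a a \<oplus>\<^bsub>M\<^esub> (\<Oplus>\<^bsub>M\<^esub> b\<in>A. c b b)"
      if "c \<in> insert a A \<rightarrow> ?E" for c
      by (rule M.finsum_insert) (use that A a EM insert.hyps in auto)
    have "pp_sol M (pp_sum R \<phi> \<psi>) =
      {[x, f x] | x. \<exists>c \<in> insert a A \<rightarrow> ?E. x = (\<Oplus>\<^bsub>M\<^esub> b\<in>insert a A. c b b)}" (is "?L = ?S")
    proof (intro equalityI subsetI)
      fix x assume "x \<in> ?L"
      then obtain g c where g: "g \<in> ?E" and c: "c \<in> A \<rightarrow> ?E"
        and x: "x = [g a \<oplus>\<^bsub>M\<^esub> (\<Oplus>\<^bsub>M\<^esub> b\<in>A. c b b), f (g a) \<oplus>\<^bsub>M\<^esub> f (\<Oplus>\<^bsub>M\<^esub> b\<in>A. c b b)]"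
        unfolding pp_sol_pp_sum[OF RM \<phi>(1) \<psi>(1) \<phi>(2)[folded \<psi>(2)]] \<phi>(3) \<psi>(3) by auto
      let ?c = "c(a := g)"
      have c': "?c \<in> insert a A \<rightarrow> ?E" using c g by auto
      have "(\<Oplus>\<^bsub>M\<^esub> b\<in>A. ?c b b) = (\<Oplus>\<^bsub>M\<^esub> b\<in>A. c b b)"
        by (rule M.finsum_cong') (use c A EM insert.hyps in auto)
      then have "x = [\<Oplus>\<^bsub>M\<^esub> b\<in>insert a A. ?c b b, f (\<Oplus>\<^bsub>M\<^esub> b\<in>insert a A. ?c b b)]"
        using x fadd[OF EM[OF g a] clA[OF c]] ins[OF c'] by simp
      then show "x \<in> ?S" using c' by blast
    next
      fix x assume "x \<in> ?S"
      then obtain c where c: "c \<in> insert a A \<rightarrow> ?E"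
        and x: "x = [\<Oplus>\<^bsub>M\<^esub> b\<in>insert a A. c b b, f (\<Oplus>\<^bsub>M\<^esub> b\<in>insert a A. c b b)]" by blast
      have cA: "c \<in> A \<rightarrow> ?E" and ca: "c a \<in> ?E" using c by auto
      let ?s = "\<Oplus>\<^bsub>M\<^esub> b\<in>A. c b b"
      have "x = map2 (\<lambda>x y. x \<oplus>\<^bsub>M\<^esub> y) [c a a, f (c a a)] [?s, f ?s]"
        using x ins[OF c] fadd[OF EM[OF ca a] clA[OF cA]] by simp
      moreover have "[c a a, f (c a a)] \<in> pp_sol M \<phi>" unfolding \<phi>(3) using ca by blast
      moreover have "[?s, f ?s] \<in> pp_sol M \<psi>" unfolding \<psi>(3) using cA by blast
      ultimately show "x \<in> ?L"
        unfolding pp_sol_pp_sum[OF RM \<phi>(1) \<psi>(1) \<phi>(2)[folded \<psi>(2)]] by blast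
    qed
    moreover have "is_pp R (pp_sum R \<phi> \<psi>)"
      by (rule is_pp_pp_sum[OF R.ring_axioms \<phi>(1) \<psi>(1)]) (simp add: \<phi> \<psi>)
    ultimately show ?case using \<phi>(2) by (intro exI[of _ "pp_sum R \<phi> \<psi>"]) simp
  qed
qed

theorem proposition4p27:
  fixes R :: "('r, 'z) ring_scheme"
    and \<D> :: "('r, ('r, 'u) univ) module set"
    and M :: "('r, ('r, 'u) univ) module"
  assumes "ring R"
    and "definable_subcategory R \<D>"
    and "M \<in> \<D>"
    and "strictly_atomic R \<D> M"
    and "finitely_generated (End_ring R M) (eval_module M)"
  shows "definable_scalars R M = Biend R M"
proof (rule Biend_eqI, intro equalityI subsetI)
  have RM: "right_module R M"
    using assms(2,3) by (auto simp: definable_subcategory_def)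
  show "f \<in> carrier (Biend R M)" if "f \<in> carrier (definable_scalars R M)" for f
    by (rule definable_scalar_in_Biend[OF RM that])
  show "f \<in> carrier (definable_scalars R M)" if f: "f \<in> carrier (Biend R M)" for f
  proof -
    from assms(5) obtain A where A: "finite A" "A \<subseteq> carrier M"
      and gen: "carrier M = {(\<Oplus>\<^bsub>M\<^esub> a\<in>A. c a a) | c. c \<in> A \<rightarrow> carrier (End_ring R M)}"
      by (auto simp: finitely_generated_def finsum_eval_module)
    from biendomorphism_graph_pp_definable[OF RM assms(3,4) f A] obtain \<rho>
      where \<rho>: "is_pp R \<rho>" "arity \<rho> = 2" and sol: "pp_sol M \<rho> =
        {[x, f x] | x. \<exists>c \<in> A \<rightarrow> carrier (End_ring R M). x = (\<Oplus>\<^bsub>M\<^esub> a\<in>A. c a a)}" by blast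
    have "{[x, f x] | x. x \<in> carrier M} = pp_sol M \<rho>"
      unfolding sol by (subst gen) blast
    moreover have "f \<in> carrier M \<rightarrow>\<^sub>E carrier M" using f by (simp add: carrier_Biend_iff)
    ultimately show ?thesis using \<rho> by (auto simp: definable_scalars_def)
  qed
qed

end
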